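(* Let $G$ be a finite undirected graph (multiple edges and loops allowed). Then: (1) each ideal $I$ of $\mathrm{Iisg}(G)$ has a basis; (2) that basis is unique up to isomorphism; (3) each generating set of graphs for an ideal $I$ of $\mathrm{Iisg}(G)$ contains a basis; (4) the union of ideals $I,J$ of $\mathrm{Iisg}(G)$ has a generating set of graphs which is the union of the bases of $I$ and $J$; (5) given any ideals $I,K$ of $\mathrm{Iisg}(G)$ with $I\subseteq K$, the elements of the basis for $I$ are induced subgraphs of the elements of the basis for $K$.
   Context: Graphs are finite and undirected and may have multiple edges and loops; the empty graph $\emptyset$ counts as a graph and the empty map $\mu_0:\emptyset\to\emptyset$ counts as a graph isomorphism. "Induced subgraph" means vertex induced subgraph. For a graph $G$, $\mathrm{Iisg}(G)$ is the set of all graph isomorphisms $\varphi:H\to J$ (bijections on vertices and on edges preserving incidence) where $H$ and $J$ are induced subgraphs of $G$. For $\varphi,\psi\in\mathrm{Iisg}(G)$ the product $\psi\circ\varphi$ is the composition of partial maps, with domain $\varphi^{-1}(\mathrm{Im}(\varphi)\cap\mathrm{Dom}(\psi))$ and image $\psi(\mathrm{Im}(\varphi)\cap\mathrm{Dom}(\psi))$. An ideal of a semigroup $S$ is a subset $I\subseteq S$ with $SI\subseteq I$ and $IS\subseteq I$. A generating set of graphs for an ideal $I$ of $\mathrm{Iisg}(G)$ is a collection $\mathcal B$ of induced subgraphs of $G$ such that for every $a\in I$ the domain of $a$ is isomorphic to an induced subgraph of some $B\in\mathcal B$, and for each $B\in\mathcal B$ there is $a\in I$ whose domain is isomorphic to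 $B$. A basis of $I$ is a generating set of graphs for $I$ that is minimal (with respect to inclusion). *)

theory Defs
  imports Main
begin

text \<open>
  An edge carries the set of its end vertices: a loop has one end, every other edge has two.
  Parallel edges are distinct edges with the same ends.
\<close>

record ('v, 'e) multigraph =
  verts :: "'v set"
  edges :: "'e set"
  ends :: "'e \<Rightarrow> 'v set"

definition finite_multigraph :: "('v, 'e) multigraph \<Rightarrow> bool" where
  "finite_multigraph G \<longleftrightarrow>
     finite (verts G) \<and> finite (edges G) \<and>
     (\<forall>e\<in>edges G. ends G e \<subseteq> verts G \<and> (card (ends G e) = 1 \<or> card (ends G e) = 2))"

text \<open>
  The end map of an induced subgraph is inherited unchanged, so that an induced subgraph of \<open>G\<close>,
  as a value of the record type, is determined by its vertex set.
\<close>

definition induced :: "('v, 'e) multigraph \<Rightarrow> 'v set \<Rightarrow> ('v, 'e) multigraph" where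
  "induced G W = \<lparr>verts = W, edges = {e \<in> edges G. ends G e \<subseteq> W}, ends = ends G\<rparr>"

definition induced_subgraph :: "('v, 'e) multigraph \<Rightarrow> ('v, 'e) multigraph \<Rightarrow> bool" where
  "induced_subgraph H G \<longleftrightarrow> (\<exists>W\<subseteq>verts G. H = induced G W)"

type_synonym ('v, 'e) pmap = "('v \<rightharpoonup> 'v) \<times> ('e \<rightharpoonup> 'e)"

definition bij_pmap :: "('a \<rightharpoonup> 'a) \<Rightarrow> 'a set \<Rightarrow> 'a set \<Rightarrow> bool" where
  "bij_pmap f A B \<longleftrightarrow> dom f = A \<and> ran f = B \<and> inj_on f (dom f)"

definition graph_iso ::
  "('v, 'e) pmap \<Rightarrow> ('v, 'e) multigraph \<Rightarrow> ('v, 'e) multigraph \<Rightarrow> bool" where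
  "graph_iso \<phi> H J \<longleftrightarrow>
     bij_pmap (fst \<phi>) (verts H) (verts J) \<and>
     bij_pmap (snd \<phi>) (edges H) (edges J) \<and>
     (\<forall>v\<in>verts H. \<forall>e\<in>edges H.
        v \<in> ends H e \<longleftrightarrow> the (fst \<phi> v) \<in> ends J (the (snd \<phi> e)))"

definition isomorphic :: "('v, 'e) multigraph \<Rightarrow> ('v, 'e) multigraph \<Rightarrow> bool"
    (infix \<open>\<simeq>\<close> 50) where
  "H \<simeq> J \<longleftrightarrow> (\<exists>\<phi>. graph_iso \<phi> H J)"

definition Iisg :: "('v, 'e) multigraph \<Rightarrow> ('v, 'e) pmap set" where
  "Iisg G = {\<phi>. \<exists>H J. induced_subgraph H G \<and> induced_subgraph J G \<and> graph_iso \<phi> H J}"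

definition pcomp :: "('v, 'e) pmap \<Rightarrow> ('v, 'e) pmap \<Rightarrow> ('v, 'e) pmap" where
  "pcomp \<psi> \<phi> = (fst \<psi> \<circ>\<^sub>m fst \<phi>, snd \<psi> \<circ>\<^sub>m snd \<phi>)"

text \<open>For \<open>\<phi> : H \<rightarrow> J\<close> in \<open>Iisg G\<close> this is \<open>H\<close>, the induced subgraph with vertex set \<open>dom (fst \<phi>)\<close>.\<close>

definition dom_graph :: "('v, 'e) multigraph \<Rightarrow> ('v, 'e) pmap \<Rightarrow> ('v, 'e) multigraph" where
  "dom_graph G \<phi> = induced G (dom (fst \<phi>))"

definition semigroup_ideal :: "('a \<Rightarrow> 'a \<Rightarrow> 'a) \<Rightarrow> 'a set \<Rightarrow> 'a set \<Rightarrow> bool" where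
  "semigroup_ideal mult S I \<longleftrightarrow>
     I \<subseteq> S \<and> (\<forall>s\<in>S. \<forall>a\<in>I. mult s a \<in> I) \<and> (\<forall>a\<in>I. \<forall>s\<in>S. mult a s \<in> I)"

abbreviation Iisg_ideal :: "('v, 'e) multigraph \<Rightarrow> ('v, 'e) pmap set \<Rightarrow> bool" where
  "Iisg_ideal G \<equiv> semigroup_ideal pcomp (Iisg G)"

definition induced_embeds :: "('v, 'e) multigraph \<Rightarrow> ('v, 'e) multigraph \<Rightarrow> bool" where
  "induced_embeds H B \<longleftrightarrow> (\<exists>K. induced_subgraph K B \<and> H \<simeq> K)"

definition generating_graphs ::
  "('v, 'e) multigraph \<Rightarrow> ('v, 'e) pmap set \<Rightarrow> ('v, 'e) multigraph set \<Rightarrow> bool" where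
  "generating_graphs G I \<B> \<longleftrightarrow>
     (\<forall>B\<in>\<B>. induced_subgraph B G) \<and>
     (\<forall>a\<in>I. \<exists>B\<in>\<B>. induced_embeds (dom_graph G a) B) \<and>
     (\<forall>B\<in>\<B>. \<exists>a\<in>I. dom_graph G a \<simeq> B)"

definition graph_basis ::
  "('v, 'e) multigraph \<Rightarrow> ('v, 'e) pmap set \<Rightarrow> ('v, 'e) multigraph set \<Rightarrow> bool" where
  "graph_basis G I \<B> \<longleftrightarrow>
     generating_graphs G I \<B> \<and> (\<forall>\<C>. \<C> \<subset> \<B> \<longrightarrow> \<not> generating_graphs G I \<C>)"

definition same_upto_iso ::
  "('v, 'e) multigraph set \<Rightarrow> ('v, 'e) multigraph set \<Rightarrow> bool" where
  "same_upto_iso \<B> \<C> \<longleftrightarrow> (\<exists>f. bij_betw f \<B> \<C> \<and> (\<forall>B\<in>\<B>. B \<simeq> f B))"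

end

theory Submission
  imports Defs
begin

text \<open>
  On the induced subgraphs of a finite graph, embeddability is a preorder whose associated
  equivalence is isomorphism, because an induced subgraph with as many vertices as the whole
  graph is the whole graph. The members of a basis are pairwise incomparable for this preorder,
  and the members of any two generating sets of the same ideal embed into one another.
\<close>

section \<open>Isomorphism as an equivalence relation\<close>

lemma bij_pmap_imp_bij_betw:
  assumes "bij_pmap f A B"
  shows "bij_betw (\<lambda>x. the (f x)) A B"
proof -
  have f: "dom f = A" "ran f = B" "inj_on f A"
    using assms unfolding bij_pmap_def by auto
  have Some_the: "f x = Some (the (f x))" if "x \<in> A" for x
    using that f(1) by force
  then have "inj_on (\<lambda>x. the (f x)) A"
    using f(3) unfolding inj_on_def by metis
  moreover have "(\<lambda>x. the (f x)) ` A = B"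
  proof
    show "(\<lambda>x. the (f x)) ` A \<subseteq> B"
      using Some_the f(2) by (blast intro: ranI)
    show "B \<subseteq> (\<lambda>x. the (f x)) ` A"
      using f(1,2) unfolding ran_def by (force simp: image_iff)
  qed
  ultimately show ?thesis unfolding bij_betw_def by blast
qed

lemma bij_betw_imp_bij_pmap:
  "bij_betw f A B \<Longrightarrow> bij_pmap (\<lambda>x. if x \<in> A then Some (f x) else None) A B"
  unfolding bij_pmap_def bij_betw_def inj_on_def ran_def
  by (auto simp: dom_def split: if_splits)

text \<open>Partial maps are the right objects for composition in \<open>Iisg G\<close>, but where
  only the existence of an isomorphism matters, total functions with irrelevant values off the graph
  are easier to compose, invert and restrict through \<open>bij_betw\<close>.\<close>

lemma isomorphic_iff:
  "H \<simeq> J \<longleftrightarrow>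
     (\<exists>f g. bij_betw f (verts H) (verts J) \<and> bij_betw g (edges H) (edges J) \<and>
       (\<forall>v\<in>verts H. \<forall>e\<in>edges H. v \<in> ends H e \<longleftrightarrow> f v \<in> ends J (g e)))"
    (is "_ \<longleftrightarrow> (\<exists>f g. ?P f g)")
proof
  assume "H \<simeq> J"
  then obtain \<phi> where "graph_iso \<phi> H J" unfolding isomorphic_def by blast
  then have "?P (\<lambda>v. the (fst \<phi> v)) (\<lambda>e. the (snd \<phi> e))"
    unfolding graph_iso_def by (blast intro: bij_pmap_imp_bij_betw)
  then show "\<exists>f g. ?P f g" by blast
next
  assume "\<exists>f g. ?P f g"
  then obtain f g where "?P f g" by blast
  \<comment> \<open>The value \<open>None\<close> off the vertex and edge sets makes the domains
    exactly these sets, as \<open>bij_pmap\<close> demands.\<close>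
  then have "graph_iso (\<lambda>v. if v \<in> verts H then Some (f v) else None,
      \<lambda>e. if e \<in> edges H then Some (g e) else None) H J"
    unfolding graph_iso_def by (simp add: bij_betw_imp_bij_pmap)
  then show "H \<simeq> J" unfolding isomorphic_def by blast
qed

lemma isomorphic_refl: "H \<simeq> H"
  unfolding isomorphic_iff by (intro exI[of _ "\<lambda>x. x"]) (simp add: bij_betw_def)

lemma isomorphic_sym:
  assumes "H \<simeq> J"
  shows "J \<simeq> H"
proof -
  obtain f g where f: "bij_betw f (verts H) (verts J)" and g: "bij_betw g (edges H) (edges J)"
    and fg: "\<forall>v\<in>verts H. \<forall>e\<in>edges H. v \<in> ends H e \<longleftrightarrow> f v \<in> ends J (g e)"
    using assms unfolding isomorphic_iff by blast
  have "v \<in> ends J e \<longleftrightarrow> inv_into (verts H) f v \<in> ends H (inv_into (edges H) g e)"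
    if "v \<in> verts J" "e \<in> edges J" for v e
    using that fg bij_betwE[OF bij_betw_inv_into[OF f]] bij_betwE[OF bij_betw_inv_into[OF g]]
    by (simp add: bij_betw_inv_into_right[OF f] bij_betw_inv_into_right[OF g])
  then show ?thesis
    unfolding isomorphic_iff using bij_betw_inv_into[OF f] bij_betw_inv_into[OF g] by blast
qed

lemma isomorphic_trans:
  assumes "H \<simeq> J" "J \<simeq> K"
  shows "H \<simeq> K"
proof -
  obtain f g where f: "bij_betw f (verts H) (verts J)" and g: "bij_betw g (edges H) (edges J)"
    and fg: "\<forall>v\<in>verts H. \<forall>e\<in>edges H. v \<in> ends H e \<longleftrightarrow> f v \<in> ends J (g e)"
    using assms(1) unfolding isomorphic_iff by blast
  obtain h k where h: "bij_betw h (verts J) (verts K)" and k: "bij_betw k (edges J) (edges K)"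
    and hk: "\<forall>v\<in>verts J. \<forall>e\<in>edges J. v \<in> ends J e \<longleftrightarrow> h v \<in> ends K (k e)"
    using assms(2) unfolding isomorphic_iff by blast
  have "v \<in> ends H e \<longleftrightarrow> (h \<circ> f) v \<in> ends K ((k \<circ> g) e)"
    if "v \<in> verts H" "e \<in> edges H" for v e
    using that fg hk bij_betwE[OF f] bij_betwE[OF g] by simp
  then show ?thesis
    unfolding isomorphic_iff using bij_betw_trans[OF f h] bij_betw_trans[OF g k] by blast
qed

lemma isomorphic_card_verts: "H \<simeq> J \<Longrightarrow> card (verts H) = card (verts J)"
  unfolding isomorphic_iff by (blast intro: bij_betw_same_card)

section \<open>Induced subgraphs and the restriction of isomorphisms\<close>

definition ends_in_verts :: "('v, 'e) multigraph \<Rightarrow> bool" where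
  "ends_in_verts H \<longleftrightarrow> (\<forall>e\<in>edges H. ends H e \<subseteq> verts H)"

lemma induced_simps [simp]:
  "verts (induced G W) = W"
  "edges (induced G W) = {e \<in> edges G. ends G e \<subseteq> W}"
  "ends (induced G W) = ends G"
  by (simp_all add: induced_def)

lemma induced_induced: "W \<subseteq> U \<Longrightarrow> induced (induced G U) W = induced G W"
  unfolding induced_def by auto

text \<open>An edge with an end outside \<open>verts H\<close> would be lost in
  \<open>induced H (verts H)\<close>; \<open>ends_in_verts\<close> excludes this, which the record
  type alone does not.\<close>

lemma induced_verts: "ends_in_verts H \<Longrightarrow> induced H (verts H) = H"
  unfolding induced_def ends_in_verts_def by (auto intro!: multigraph.equality)

lemma induced_subgraph_ends_in_verts: "induced_subgraph H G \<Longrightarrow> ends_in_verts H"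
  unfolding induced_subgraph_def ends_in_verts_def by auto

lemma induced_subgraph_trans:
  "induced_subgraph H J \<Longrightarrow> induced_subgraph J K \<Longrightarrow> induced_subgraph H K"
  unfolding induced_subgraph_def by (elim exE conjE) (auto simp: induced_induced)

text \<open>If \<open>K\<close> is induced on \<open>W\<close>, its copy in \<open>J\<close> is
  induced on \<open>f\<close> W\<open>: an isomorphism maps end sets to end sets, so the edges
  inside\<close>W\<open>go exactly onto the edges inside\<close>f \<open>W\<close>.\<close>

lemma isomorphic_restrict:
  assumes "H \<simeq> J" "ends_in_verts H" "ends_in_verts J" "induced_subgraph K H"
  shows "induced_embeds K J"
proof -
  obtain f g where f: "bij_betw f (verts H) (verts J)" and g: "bij_betw g (edges H) (edges J)"
    and fg: "\<And>v e. v \<in> verts H \<Longrightarrow> e \<in> edges H \<Longrightarrow> v \<in> ends H e \<longleftrightarrow> f v \<in> ends J (g e)"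
    using assms(1) unfolding isomorphic_iff by blast
  obtain W where W: "W \<subseteq> verts H" and K: "K = induced H W"
    using assms(4) unfolding induced_subgraph_def by blast
  \<comment> \<open>The incidence condition only compares vertices of \<open>H\<close> with their
    images. It fixes whole end sets because all ends lie in the vertex sets and \<open>f\<close> is
    onto \<open>verts J\<close>.\<close>
  have ends_g: "ends J (g e) = f ` ends H e" if "e \<in> edges H" for e
  proof -
    have "g e \<in> edges J" using bij_betwE[OF g] that by blast
    then have "ends J (g e) \<subseteq> f ` verts H" "ends H e \<subseteq> verts H"
      using assms(2,3) that bij_betw_imp_surj_on[OF f] unfolding ends_in_verts_def by auto
    then show ?thesis using fg[OF _ that] by blast
  qed
  have sub: "ends J (g e) \<subseteq> f ` W \<longleftrightarrow> ends H e \<subseteq> W" if "e \<in> edges H" for e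
  proof -
    have "ends H e \<subseteq> verts H" using assms(2) that unfolding ends_in_verts_def by blast
    then show ?thesis
      unfolding ends_g[OF that] using inj_on_image_mem_iff[OF bij_betw_imp_inj_on[OF f] _ W] by blast
  qed
  have "bij_betw f W (f ` W)"
    using f W by (blast intro: bij_betw_subset)
  moreover have "g ` {e \<in> edges H. ends H e \<subseteq> W} = {e \<in> edges J. ends J e \<subseteq> f ` W}"
    using sub unfolding bij_betw_imp_surj_on[OF g, symmetric] by auto
  then have "bij_betw g {e \<in> edges H. ends H e \<subseteq> W} {e \<in> edges J. ends J e \<subseteq> f ` W}"
    using g by (auto intro: bij_betw_subset)
  ultimately have "K \<simeq> induced J (f ` W)"
    unfolding isomorphic_iff K using fg W by (intro exI[of _ f] exI[of _ g]) auto
  moreover have "f ` W \<subseteq> verts J" using W bij_betw_imp_surj_on[OF f] by blast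
  ultimately show ?thesis unfolding induced_embeds_def induced_subgraph_def by blast
qed

section \<open>The embeddability preorder\<close>

lemma isomorphic_imp_induced_embeds: "H \<simeq> J \<Longrightarrow> ends_in_verts J \<Longrightarrow> induced_embeds H J"
  unfolding induced_embeds_def induced_subgraph_def by (metis induced_verts subset_refl)

lemma isomorphic_induced_embeds: "H \<simeq> J \<Longrightarrow> induced_embeds J K \<Longrightarrow> induced_embeds H K"
  unfolding induced_embeds_def by (blast intro: isomorphic_trans)

text \<open>The isomorphism from \<open>J\<close> onto its copy in \<open>K\<close> is restricted to
  the copy of \<open>H\<close> inside \<open>J\<close>.\<close>

lemma induced_embeds_trans:
  assumes "induced_embeds H J" "induced_embeds J K" "ends_in_verts J"
  shows "induced_embeds H K"
proof -
  obtain H' where H': "induced_subgraph H' J" "H \<simeq> H'"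
    using assms(1) unfolding induced_embeds_def by blast
  obtain J' where J': "induced_subgraph J' K" "J \<simeq> J'"
    using assms(2) unfolding induced_embeds_def by blast
  have "induced_embeds H' J'"
    using isomorphic_restrict J' H'(1) assms(3) induced_subgraph_ends_in_verts by blast
  then have "induced_embeds H' K"
    using J'(1) induced_subgraph_trans unfolding induced_embeds_def by blast
  then show ?thesis using H'(2) isomorphic_induced_embeds by blast
qed

text \<open>Embeddings cannot decrease the number of vertices, so mutual embedding makes the two
  counts equal. Edges need no separate count, since an induced subgraph is fixed by its vertex
  set.\<close>

lemma induced_embeds_antisym:
  fixes H J :: "('v, 'e) multigraph"
  assumes "induced_embeds H J" "induced_embeds J H"
    and "finite (verts H)" "finite (verts J)" "ends_in_verts J"
  shows "H \<simeq> J"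
proof -
  have card_le: "card (verts A) \<le> card (verts B)"
    if AB: "induced_embeds A B" and fin: "finite (verts B)" for A B :: "('v, 'e) multigraph"
  proof -
    obtain W where "W \<subseteq> verts B" "A \<simeq> induced B W"
      using AB unfolding induced_embeds_def induced_subgraph_def by blast
    then show ?thesis using isomorphic_card_verts[of A "induced B W"] card_mono[OF fin] by simp
  qed
  obtain W where W: "W \<subseteq> verts J" "H \<simeq> induced J W"
    using assms(1) unfolding induced_embeds_def induced_subgraph_def by blast
  \<comment> \<open>The embedding of \<open>J\<close> into \<open>H\<close> bounds
    \<open>card (verts J)\<close> by \<open>card (verts H)\<close>, which equals
    \<open>card W\<close>.\<close>
  have "card (verts J) \<le> card W"
    using card_le[OF assms(2,3)] isomorphic_card_verts[OF W(2)] by simp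
  then have "W = verts J" using W(1) assms(4) by (simp add: card_seteq)
  then show ?thesis using W(2) induced_verts[OF assms(5)] by simp
qed

section \<open>Generating sets and bases\<close>

lemma finite_induced_subgraphs:
  assumes "finite (verts G)"
  shows "finite {H. induced_subgraph H G}"
proof -
  \<comment> \<open>Since the end map is inherited unchanged, each vertex set yields just one
    record; end maps free to vary off the edges could give infinitely many.\<close>
  have "{H. induced_subgraph H G} = induced G ` Pow (verts G)"
    unfolding induced_subgraph_def by blast
  then show ?thesis using assms by simp
qed

text \<open>If \<open>a\<close> is an isomorphism from \<open>induced G W\<close>, then
  \<open>dom (fst a) = W\<close>, so \<open>dom_graph\<close> recovers its domain.\<close>

lemma dom_graph_induced_subgraph:
  assumes "a \<in> Iisg G"
  shows "induced_subgraph (dom_graph G a) G"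
proof -
  obtain W J where "W \<subseteq> verts G" "graph_iso a (induced G W) J"
    using assms unfolding Iisg_def induced_subgraph_def by blast
  then show ?thesis
    unfolding induced_subgraph_def dom_graph_def graph_iso_def bij_pmap_def by auto
qed

text \<open>This supplies a first generating set for every ideal, from which a basis can then be
  extracted.\<close>

lemma generating_graphs_dom_graphs:
  assumes "I \<subseteq> Iisg G"
  shows "generating_graphs G I (dom_graph G ` I)"
proof -
  have "\<forall>a\<in>I. induced_subgraph (dom_graph G a) G"
    using assms dom_graph_induced_subgraph by blast
  moreover from this have "\<forall>a\<in>I. induced_embeds (dom_graph G a) (dom_graph G a)"
    using isomorphic_imp_induced_embeds isomorphic_refl induced_subgraph_ends_in_verts by blast
  ultimately show ?thesis
    unfolding generating_graphs_def using isomorphic_refl by blast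
qed

text \<open>There are only finitely many induced subgraphs, so passing repeatedly to a proper
  generating subset must stop, and it stops at a minimal one.\<close>

lemma generating_graphs_contains_basis:
  assumes "finite (verts G)" "generating_graphs G I \<G>"
  shows "\<exists>\<B>\<subseteq>\<G>. graph_basis G I \<B>"
proof -
  have "\<G> \<subseteq> {H. induced_subgraph H G}"
    using assms(2) unfolding generating_graphs_def by blast
  then have "finite \<G>"
    using finite_induced_subgraphs[OF assms(1)] by (rule finite_subset)
  then show ?thesis
    using assms(2)
  proof (induction \<G> rule: finite_psubset_induct)
    case (psubset \<G>)
    show ?case
    proof (cases "\<exists>\<C>. \<C> \<subset> \<G> \<and> generating_graphs G I \<C>")
      case True
      then obtain \<C> where "\<C> \<subset> \<G>" "generating_graphs G I \<C>" by blast
      with psubset.IH[of \<C>] show ?thesis by blast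
    next
      case False
      then show ?thesis using psubset.prems unfolding graph_basis_def by blast
    qed
  qed
qed

text \<open>\<open>B\<close> is, up to isomorphism, the domain of some \<open>a\<close> in
  \<open>I\<close>, hence in \<open>K\<close>, and \<open>\<C>\<close> covers that domain. The case
  \<open>I = K\<close> serves uniqueness; the general case compares the bases of nested
  ideals.\<close>

lemma generating_graphs_mono_embeds:
  assumes "generating_graphs G I \<B>" "generating_graphs G K \<C>" "I \<subseteq> K" "B \<in> \<B>"
  shows "\<exists>C\<in>\<C>. induced_embeds B C"
proof -
  obtain a where "a \<in> I" "dom_graph G a \<simeq> B"
    using assms(1,4) unfolding generating_graphs_def by blast
  moreover from this obtain C where "C \<in> \<C>" "induced_embeds (dom_graph G a) C"
    using assms(2,3) unfolding generating_graphs_def by blast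
  ultimately show ?thesis using isomorphic_sym isomorphic_induced_embeds by blast
qed

text \<open>If \<open>B\<close> embedded in another member \<open>B'\<close>, then \<open>B'\<close>
  would cover every domain that \<open>B\<close> covers, and \<open>B\<close> could be dropped
  against minimality.\<close>

lemma graph_basis_incomparable:
  assumes basis: "graph_basis G I \<B>" and B: "B \<in> \<B>" "B' \<in> \<B>" and BB': "induced_embeds B B'"
  shows "B = B'"
proof (rule ccontr)
  assume "B \<noteq> B'"
  have gen: "generating_graphs G I \<B>" using basis unfolding graph_basis_def by blast
  then have ends: "ends_in_verts B"
    using B(1) induced_subgraph_ends_in_verts unfolding generating_graphs_def by blast
  have "\<exists>C\<in>\<B> - {B}. induced_embeds (dom_graph G a) C" if "a \<in> I" for a
  proof -
    obtain C where C: "C \<in> \<B>" "induced_embeds (dom_graph G a) C"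
      using gen \<open>a \<in> I\<close> unfolding generating_graphs_def by blast
    show ?thesis
    proof (cases "C = B")
      case True
      then have "induced_embeds (dom_graph G a) B'"
        using C(2) BB' ends induced_embeds_trans by blast
      then show ?thesis using B(2) \<open>B \<noteq> B'\<close> by blast
    next
      case False
      then show ?thesis using C by blast
    qed
  qed
  \<comment> \<open>The other two conditions of \<open>generating_graphs\<close> concern each member
    separately and so pass to the smaller family.\<close>
  then have "generating_graphs G I (\<B> - {B})"
    using gen unfolding generating_graphs_def by blast
  moreover have "\<B> - {B} \<subset> \<B>" using B(1) by blast
  ultimately show False using basis unfolding graph_basis_def by blast
qed

text \<open>Going across and back, \<open>B\<close> embeds in some \<open>C\<close> and
  \<open>C\<close> in some \<open>B'\<close> of \<open>\<B>\<close>. Incomparability gives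
  \<open>B = B'\<close>, and antisymmetry then gives \<open>B \<simeq> C\<close>.\<close>

lemma graph_basis_isomorphic_member:
  assumes "finite (verts G)" "graph_basis G I \<B>" "graph_basis G I \<C>" "B \<in> \<B>"
  shows "\<exists>C\<in>\<C>. B \<simeq> C"
proof -
  have gen: "generating_graphs G I \<B>" "generating_graphs G I \<C>"
    using assms(2,3) unfolding graph_basis_def by blast+
  obtain C where C: "C \<in> \<C>" "induced_embeds B C"
    using generating_graphs_mono_embeds[OF gen subset_refl assms(4)] by blast
  obtain B' where B': "B' \<in> \<B>" "induced_embeds C B'"
    using generating_graphs_mono_embeds[OF gen(2,1) subset_refl C(1)] by blast
  have sub: "induced_subgraph B G" "induced_subgraph C G"
    using gen assms(4) C(1) unfolding generating_graphs_def by blast+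
  then have "finite (verts B)" "finite (verts C)"
    using assms(1) unfolding induced_subgraph_def by (auto dest: finite_subset)
  moreover have ends: "ends_in_verts C" using sub(2) by (rule induced_subgraph_ends_in_verts)
  moreover have "B = B'"
    using graph_basis_incomparable[OF assms(2,4) B'(1)] induced_embeds_trans[OF C(2) B'(2) ends]
    by blast
  ultimately have "B \<simeq> C" using induced_embeds_antisym C(2) B'(2) by blast
  then show ?thesis using C(1) by blast
qed

text \<open>A basis contains at most one graph of each isomorphism type, because isomorphic members
  embed in each other. This turns the matching between two bases into a bijection.\<close>

lemma graph_basis_isomorphic_eq:
  assumes "graph_basis G I \<B>" "B \<in> \<B>" "B' \<in> \<B>" "B \<simeq> B'"
  shows "B = B'"
proof -
  have "induced_subgraph B' G"
    using assms(1,3) unfolding graph_basis_def generating_graphs_def by blast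
  then have "induced_embeds B B'"
    using assms(4) isomorphic_imp_induced_embeds induced_subgraph_ends_in_verts by blast
  then show ?thesis using graph_basis_incomparable assms(1-3) by blast
qed

lemma graph_basis_unique:
  assumes "finite (verts G)" "graph_basis G I \<B>" "graph_basis G I \<C>"
  shows "same_upto_iso \<B> \<C>"
proof -
  obtain f where f: "\<forall>B\<in>\<B>. f B \<in> \<C> \<and> B \<simeq> f B"
    using graph_basis_isomorphic_member[OF assms] by metis
  have "inj_on f \<B>"
  proof (rule inj_onI)
    fix B B' assume "B \<in> \<B>" "B' \<in> \<B>" "f B = f B'"
    then have "B \<simeq> B'" using f isomorphic_sym isomorphic_trans by metis
    then show "B = B'" using graph_basis_isomorphic_eq assms(2) \<open>B \<in> \<B>\<close> \<open>B' \<in> \<B>\<close> by blast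
  qed
  \<comment> \<open>A partner \<open>B\<close> of \<open>C\<close> in \<open>\<B>\<close> satisfies
    \<open>C \<simeq> B \<simeq> f B\<close>; as \<open>C\<close> and \<open>f B\<close> both lie in
    the basis \<open>\<C>\<close>, they coincide.\<close>
  moreover have "\<C> \<subseteq> f ` \<B>"
  proof
    fix C assume "C \<in> \<C>"
    then obtain B where "B \<in> \<B>" "C \<simeq> B"
      using graph_basis_isomorphic_member[OF assms(1,3,2)] by blast
    then have "C \<simeq> f B" using f isomorphic_trans by blast
    then have "C = f B" using graph_basis_isomorphic_eq assms(3) \<open>C \<in> \<C>\<close> \<open>B \<in> \<B>\<close> f by blast
    then show "C \<in> f ` \<B>" using \<open>B \<in> \<B>\<close> by blast
  qed
  ultimately show ?thesis
    using f unfolding same_upto_iso_def bij_betw_def by blast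
qed

section \<open>Unions of ideals and the five claims\<close>

lemma semigroup_ideal_Un:
  "semigroup_ideal mult S I \<Longrightarrow> semigroup_ideal mult S J \<Longrightarrow> semigroup_ideal mult S (I \<union> J)"
  unfolding semigroup_ideal_def by blast

text \<open>Each condition is checked one element or one graph at a time, so it survives unions.
  Minimality may not survive: a member of one family can embed in a member of the other.\<close>

lemma generating_graphs_Un:
  "generating_graphs G I \<B> \<Longrightarrow> generating_graphs G J \<C> \<Longrightarrow>
    generating_graphs G (I \<union> J) (\<B> \<union> \<C>)"
  unfolding generating_graphs_def by blast

theorem theorem4p18:
  fixes G :: "('v, 'e) multigraph"
  assumes "finite_multigraph G"
  shows "(\<forall>I. Iisg_ideal G I \<longrightarrow> (\<exists>\<B>. graph_basis G I \<B>)) \<and>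
    (\<forall>I \<B> \<C>. Iisg_ideal G I \<and> graph_basis G I \<B> \<and> graph_basis G I \<C> \<longrightarrow> same_upto_iso \<B> \<C>) \<and>
    (\<forall>I \<G>. Iisg_ideal G I \<and> generating_graphs G I \<G> \<longrightarrow> (\<exists>\<B>\<subseteq>\<G>. graph_basis G I \<B>)) \<and>
    (\<forall>I J \<B> \<C>. Iisg_ideal G I \<and> Iisg_ideal G J \<and> graph_basis G I \<B> \<and> graph_basis G J \<C> \<longrightarrow>
       Iisg_ideal G (I \<union> J) \<and> generating_graphs G (I \<union> J) (\<B> \<union> \<C>)) \<and>
    (\<forall>I K \<B> \<C>. Iisg_ideal G I \<and> Iisg_ideal G K \<and> I \<subseteq> K \<and>
       graph_basis G I \<B> \<and> graph_basis G K \<C> \<longrightarrow>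
       (\<forall>B\<in>\<B>. \<exists>C\<in>\<C>. induced_embeds B C))"
proof -
  have fin: "finite (verts G)" using assms unfolding finite_multigraph_def by blast
  have basis_gen: "generating_graphs G I \<B>" if "graph_basis G I \<B>" for I \<B>
    using that unfolding graph_basis_def by blast
  have "\<exists>\<B>. graph_basis G I \<B>" if "Iisg_ideal G I" for I
  proof -
    have "I \<subseteq> Iisg G" using that unfolding semigroup_ideal_def by blast
    then show ?thesis
      using generating_graphs_contains_basis[OF fin generating_graphs_dom_graphs] by blast
  qed
  moreover have "\<exists>C\<in>\<C>. induced_embeds B C"
    if "I \<subseteq> K" "graph_basis G I \<B>" "graph_basis G K \<C>" "B \<in> \<B>" for I K \<B> \<C> B
    using generating_graphs_mono_embeds that basis_gen by blast
  moreover have "generating_graphs G (I \<union> J) (\<B> \<union> \<C>)"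
    if "graph_basis G I \<B>" "graph_basis G J \<C>" for I J \<B> \<C>
    using generating_graphs_Un that basis_gen by blast
  moreover have "same_upto_iso \<B> \<C>" if "graph_basis G I \<B>" "graph_basis G I \<C>" for I \<B> \<C>
    using graph_basis_unique[OF fin] that by blast
  \<comment> \<open>Clause (3) is \<open>generating_graphs_contains_basis\<close> itself, and the
    ideal half of clause (4) is \<open>semigroup_ideal_Un\<close>; the rest has been collected
    above.\<close>
  ultimately show ?thesis
    by (intro conjI allI impI)
      (meson generating_graphs_contains_basis[OF fin] semigroup_ideal_Un)+
qed

end
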